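(* Let $p\ge 7$ be a prime and let $n\ge r\ge 0$ be integers. Then, as a congruence of $p$-integral rational numbers, $$\binom{np}{rp}\Big/\binom{n}{r}\equiv 1+w_p\,n\,r\,(n-r)\,p^3 \pmod{p^5}.$$ Moreover, the congruence $\binom{np}{rp}\big/\binom{n}{r}\equiv 1\pmod{p^4}$ holds for all integers $n\ge r\ge 0$ if and only if $p$ divides the numerator of the Bernoulli number $B_{p-3}$.
   Context: For a prime $p\ge 5$, let $H_1(p-1)=\sum_{k=1}^{p-1}\frac1k$; by Wolstenholme's theorem $H_1(p-1)\equiv 0\pmod{p^2}$, so $H_1(p-1)/p^2$ is a $p$-integral rational number. Define $w_p$ to be the unique integer with $0\le w_p<p^2$ and $w_p\equiv H_1(p-1)/p^2\pmod{p^2}$. Bernoulli numbers $B_k$ are defined by $\frac{x}{e^x-1}=\sum_{k\ge0}B_k\frac{x^k}{k!}$. *)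

theory Defs
  imports "HOL-Computational_Algebra.Computational_Algebra"
begin

definition p_integral :: "nat \<Rightarrow> rat \<Rightarrow> bool" where
  "p_integral p x \<longleftrightarrow> \<not> int p dvd snd (quotient_of x)"

(* rat_cong p k x y: the congruence x = y (mod p ^ k) in the ring of p-integral rationals.
   The p-integrality of both sides is part of the relation. *)
definition rat_cong :: "nat \<Rightarrow> nat \<Rightarrow> rat \<Rightarrow> rat \<Rightarrow> bool" where
  "rat_cong p k x y \<longleftrightarrow>
     p_integral p x \<and> p_integral p y \<and> p_integral p ((x - y) / of_nat p ^ k)"

definition H1 :: "nat \<Rightarrow> rat" where
  "H1 n = (\<Sum>k=1..n. 1 / of_nat k)"

(* Existence of w_p is Wolstenholme's theorem, so the value is meaningful for primes p \<ge> 5. *)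
definition w :: "nat \<Rightarrow> int" where
  "w p = (THE a. 0 \<le> a \<and> a < int p ^ 2 \<and>
                 rat_cong p 2 (of_int a) (H1 (p - 1) / of_nat p ^ 2))"

(* Division of formal power series cancels the common factor X here;
   see bernoulli_generating_function below. *)
definition bernoulli :: "nat \<Rightarrow> rat" where
  "bernoulli k = fact k * fps_nth (fps_X / (fps_exp 1 - 1)) k"

lemma bernoulli_generating_function:
  "Abs_fps (\<lambda>k. bernoulli k / fact k) * (fps_exp 1 - 1) = fps_X"
proof -
  let ?E = "fps_exp 1 - 1 :: rat fps"
  have n1: "fps_nth ?E 1 \<noteq> 0" and n0: "fps_nth ?E 0 = 0" by simp_all
  have "subdegree ?E = 1" using n1 n0 by (intro subdegreeI) auto
  moreover have "?E \<noteq> 0" using n1 by (metis fps_zero_nth)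
  ultimately have "?E dvd fps_X" by (simp add: fps_dvd_iff)
  moreover have "Abs_fps (\<lambda>k. bernoulli k / fact k) = fps_X / ?E"
    by (simp add: fps_eq_iff bernoulli_def)
  ultimately show ?thesis by simp
qed

end

theory Submission
  imports Defs "HOL-Number_Theory.Residues"
begin

text \<open>
  Let \<open>F m = (\<Prod>k=1..p-1. 1 + m p / k)\<close>. Removing the multiples of \<open>p\<close> from the factorials shows
  that the quotient of the two binomial coefficients is
  \<open>(\<Prod>m<n. F m) / ((\<Prod>m<r. F m) (\<Prod>m<n-r. F m))\<close>. Pairing \<open>k\<close> with \<open>p - k\<close> gives
  \<open>(F m)\<^sup>2 = (\<Prod>k=1..p-1. 1 + m (m + 1) p\<^sup>2 / (k (p - k)))\<close>. The first elementary symmetric function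
  of the numbers \<open>1 / (k (p - k))\<close> is \<open>2 p W\<close> with \<open>W = H1 (p - 1) / p\<^sup>2\<close>, and the second one is
  divisible by \<open>p\<close> because the sum of the \<open>1 / k\<^sup>4\<close> is. So \<open>F m\<close> is \<open>1 + m (m + 1) p\<^sup>3 W\<close> modulo
  \<open>p\<^sup>5\<close>, and these contributions add up to \<open>n r (n - r) p\<^sup>3 W\<close>.

  For the Bernoulli criterion, write \<open>S = (\<Sum>k=1..p-1. 1 / k\<^sup>2)\<close> and
  \<open>T = (\<Sum>k=1..p-1. H1 (k - 1) / k\<^sup>2)\<close>. Modulo \<open>p\<^sup>3\<close>, reflection gives \<open>2 H1 (p - 1) + p S = 0\<close>,
  while the identity \<open>(\<Sum>k=1..p. (-1) ^ (k - 1) (p choose k) / k) = H1 p\<close> gives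
  \<open>H1 (p - 1) = p S - p\<^sup>2 T\<close>; hence \<open>3 W = - T\<close> modulo \<open>p\<close>. Finally, replacing \<open>1 / j\<close> by
  \<open>j ^ (p - 2)\<close> and applying Faulhaber's formula to the inner sum of \<open>T\<close> leaves only the term of
  \<open>bernoulli (p - 3)\<close> modulo \<open>p\<close>.
\<close>

text \<open>For prime \<open>p\<close> this is the ideal generated by \<open>p ^ k\<close> in the
  integers localized at \<open>p\<close>; \<open>k = 0\<close> gives the whole local ring.
  Congruences are handled below as membership of a difference.\<close>

definition padic_ideal :: "nat \<Rightarrow> nat \<Rightarrow> rat set" where
  "padic_ideal p k = {x. p_integral p (x / of_nat p ^ k)}"

section \<open>Bernoulli numbers and Faulhaber's formula\<close>

text \<open>The exponentials form a geometric progression, so multiplying by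
  \<open>fps_exp 1 - 1\<close> telescopes; the Bernoulli generating function turns that factor into
  \<open>fps_X\<close>.\<close>

lemma sum_exp_times_fps_X:
  "(\<Sum>j<k. fps_exp (of_nat j)) * fps_X
     = (fps_exp (of_nat k) - 1) * Abs_fps (\<lambda>i. bernoulli i / fact i)" (is "?S * _ = _ * ?B")
proof -
  have "?S * (fps_exp 1 - 1) = fps_exp (of_nat k :: rat) - 1"
    by (induction k) (simp_all add: algebra_simps fps_exp_add_mult)
  then have "(fps_exp (of_nat k) - 1) * ?B = ?S * (?B * (fps_exp 1 - 1))"
    by (simp add: mult.assoc mult.commute[of ?B])
  then show ?thesis by (simp only: bernoulli_generating_function)
qed

text \<open>Faulhaber's formula, by comparing coefficients of degree \<open>Suc m\<close> in the
  preceding identity.\<close>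

lemma sum_powers_bernoulli:
  "of_nat (Suc m) * (\<Sum>j<k. of_nat j ^ m :: rat)
     = (\<Sum>i\<le>m. of_nat (Suc m choose i) * bernoulli i * of_nat k ^ (Suc m - i))"
proof -
  have "(\<Sum>j<k. of_nat j ^ m / fact m :: rat)
      = fps_nth ((\<Sum>j<k. fps_exp (of_nat j)) * fps_X) (Suc m)"
    by (simp add: fps_sum_nth)
  also have "\<dots> = fps_nth (Abs_fps (\<lambda>i. bernoulli i / fact i) * (fps_exp (of_nat k) - 1)) (Suc m)"
    by (metis sum_exp_times_fps_X mult.commute)
  also have "\<dots> = (\<Sum>i\<le>m. bernoulli i / fact i * (of_nat k ^ (Suc m - i) / fact (Suc m - i)))"
    \<comment> \<open>The term \<open>i = Suc m\<close> of the convolution drops out because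
      \<open>fps_exp (of_nat k) - 1\<close> has constant coefficient 0.\<close>
    unfolding fps_mult_nth atLeast0AtMost sum.atMost_Suc
    by (simp add: Suc_diff_le del: fact_Suc)
  finally have "fact (Suc m) * (\<Sum>j<k. of_nat j ^ m / fact m :: rat)
    = (\<Sum>i\<le>m. fact (Suc m) * (bernoulli i / fact i * (of_nat k ^ (Suc m - i) / fact (Suc m - i))))"
    by (simp add: sum_distrib_left)
  also have "\<dots> = (\<Sum>i\<le>m. of_nat (Suc m choose i) * bernoulli i * of_nat k ^ (Suc m - i))"
    by (intro sum.cong refl) (simp add: binomial_fact del: fact_Suc)
  also have "fact (Suc m) * (\<Sum>j<k. of_nat j ^ m / fact m :: rat)
      = of_nat (Suc m) * (\<Sum>j<k. of_nat j ^ m)"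
    by (simp flip: sum_divide_distrib)
  finally show ?thesis .
qed

section \<open>Binomial identities over the rationals\<close>

text \<open>Pascal's rule splits off the sum for \<open>n\<close>. By absorption, the rest is an
  alternating row sum divided by \<open>Suc n\<close>, which contributes exactly the new summand of
  \<open>H1\<close>.\<close>

lemma alternating_binomial_harmonic:
  "(\<Sum>k=1..n. (-1) ^ (k - 1) * of_nat (n choose k) / of_nat k) = H1 n"
proof (induction n)
  case 0
  then show ?case by (simp add: H1_def)
next
  case (Suc n)
  have absorb: "(-1) ^ (k - 1) * of_nat (n choose (k - 1)) / of_nat k
      = - ((-1) ^ k * of_nat (Suc n choose k)) / (of_nat (Suc n) :: rat)" if k: "k \<in> {1..Suc n}" for k
  proof -
    obtain l where l: "k = Suc l" using k by (cases k) simp_all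
    have "of_nat (Suc l) * of_nat (Suc n choose Suc l) = (of_nat (Suc n) * of_nat (n choose l) :: rat)"
      by (metis Suc_times_binomial of_nat_mult)
    then show ?thesis unfolding l by (simp add: field_simps del: of_nat_Suc binomial_Suc_Suc)
  qed
  have "(\<Sum>k\<le>Suc n. (-1) ^ k * of_nat (Suc n choose k)) = (0 :: rat)"
    by (rule choose_alternating_sum) simp
  \<comment> \<open>The full alternating row sum is 0, so removing its \<open>k = 0\<close> term 1
    leaves -1.\<close>
  then have alt: "(\<Sum>k=1..Suc n. (-1) ^ k * of_nat (Suc n choose k)) = (- 1 :: rat)"
    unfolding atMost_atLeast0 by (subst (asm) sum.atLeast_Suc_atMost) (auto simp: add_eq_0_iff)
  have "(\<Sum>k=1..Suc n. (-1) ^ (k - 1) * of_nat (Suc n choose k) / of_nat k :: rat)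
     = (\<Sum>k=1..Suc n. (-1) ^ (k - 1) * of_nat (n choose k) / of_nat k
           + (-1) ^ (k - 1) * of_nat (n choose (k - 1)) / of_nat k)"
    by (intro sum.cong refl) (auto simp: choose_reduce_nat algebra_simps add_divide_distrib)
  also have "\<dots> = (\<Sum>k=1..n. (-1) ^ (k - 1) * of_nat (n choose k) / of_nat k)
      + (\<Sum>k=1..Suc n. (-1) ^ (k - 1) * of_nat (n choose (k - 1)) / of_nat k)"
    by (simp add: sum.distrib)
  also have "(\<Sum>k=1..Suc n. (-1) ^ (k - 1) * of_nat (n choose (k - 1)) / of_nat k :: rat)
      = (\<Sum>k=1..Suc n. - ((-1) ^ k * of_nat (Suc n choose k)) / of_nat (Suc n))"
    by (intro sum.cong refl absorb)
  also have "\<dots> = 1 / of_nat (Suc n)"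
    by (simp only: alt sum_negf minus_minus flip: sum_divide_distrib)
  finally show ?case
    unfolding Suc by (simp add: H1_def)
qed

text \<open>Each factor equals \<open>- (p - j) / j\<close>. In this form the signed binomial
  coefficient can be expanded in powers of \<open>p\<close>.\<close>

lemma signed_binomial_eq_prod:
  assumes "k < p"
  shows "(-1) ^ k * of_nat ((p - 1) choose k) = (\<Prod>j=1..k. 1 - of_nat p / of_nat j :: rat)"
  using assms
proof (induction k)
  case (Suc k)
  have "Suc k * ((p - 1) choose Suc k) = (p - 1 - k) * ((p - 1) choose k)"
    by (metis binomial_absorb_comp binomial_absorption)
  then have "of_nat (Suc k) * of_nat ((p - 1) choose Suc k)
      = (of_nat (p - 1 - k) * of_nat ((p - 1) choose k) :: rat)"
    by (metis of_nat_mult)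
  also have "of_nat (p - 1 - k) = (of_nat p - of_nat (Suc k) :: rat)"
    using Suc.prems by (simp add: of_nat_diff)
  finally have "of_nat ((p - 1) choose Suc k)
      = - (1 - of_nat p / of_nat (Suc k)) * (of_nat ((p - 1) choose k) :: rat)"
    by (simp add: field_simps del: of_nat_Suc)
  moreover have "(-1) ^ k * of_nat ((p - 1) choose k) = (\<Prod>j=1..k. 1 - of_nat p / of_nat j :: rat)"
    using Suc by simp
  ultimately show ?case
    by (simp only: prod.nat_ivl_Suc' power_Suc) (simp add: algebra_simps flip: prod.nat_ivl_Suc')
qed simp

section \<open>Factorials of multiples of \<open>p\<close>\<close>

text \<open>This is \<open>F m\<close> of the overview: the product of the integers strictly between
  \<open>m * p\<close> and \<open>(m + 1) * p\<close>, divided by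
  \<open>fact (p - 1)\<close>.\<close>

definition row_quotient :: "nat \<Rightarrow> nat \<Rightarrow> rat" where
  "row_quotient p m = (\<Prod>k=1..p-1. 1 + of_nat m * of_nat p / of_nat k)"

text \<open>The factors of the factorial are grouped into \<open>n\<close> rows of \<open>p\<close>
  consecutive integers; each row ends in a multiple of \<open>p\<close>, and its other factors give
  \<open>fact (p - 1)\<close> times a row quotient.\<close>

lemma fact_mult_eq_prod_row_quotients:
  assumes "p > 0"
  shows "(fact (n * p) :: rat)
    = of_nat p ^ n * fact n * fact (p - 1) ^ n
        * (\<Prod>m<n. row_quotient p m)"
proof (induction n)
  case (Suc n)
  have fact_add: "fact (a + b) = fact a * (\<Prod>k=1..b. of_nat a + of_nat k :: rat)" for a b
    by (induction b) (simp_all add: algebra_simps)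
  have row: "(\<Prod>k=1..p-1. of_nat (n * p) + of_nat k :: rat)
      = fact (p - 1) * row_quotient p n"
    unfolding row_quotient_def fact_prod of_nat_prod prod.distrib[symmetric]
    by (intro prod.cong refl) (simp add: field_simps)
  have "{1..p} = insert p {1..p-1}" using assms by auto
  then have "(\<Prod>k=1..p. of_nat (n * p) + of_nat k :: rat)
      = of_nat (Suc n) * of_nat p * (\<Prod>k=1..p-1. of_nat (n * p) + of_nat k)"
    using assms by (simp add: algebra_simps)
  moreover have "(fact (Suc n * p) :: rat) = fact (n * p) * (\<Prod>k=1..p. of_nat (n * p) + of_nat k)"
    using fact_add[of "n * p" p] by (simp add: add.commute)
  ultimately show ?case unfolding Suc row by (simp add: algebra_simps)
qed simp

section \<open>Arithmetic in the local ring at \<open>p\<close>\<close>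

context
  fixes p :: nat
  assumes prime_p: "prime p"
begin

private abbreviation I :: "nat \<Rightarrow> rat set" where "I \<equiv> padic_ideal p"

text \<open>The reduced denominator divides every other denominator, so any representation with
  denominator prime to \<open>p\<close> is enough.\<close>

lemma p_integral_fractionI:
  assumes "\<not> int p dvd b"
  shows "p_integral p (of_int a / of_int b)"
proof -
  obtain c d where cd: "quotient_of (of_int a / of_int b :: rat) = (c, d)" by fastforce
  have d: "d > 0" and cop: "coprime c d" and eq: "of_int a / of_int b = (of_int c / of_int d :: rat)"
    using quotient_of_denom_pos[OF cd] quotient_of_coprime[OF cd] quotient_of_div[OF cd] by auto
  have "b \<noteq> 0" using assms by auto
  with eq d have "of_int (a * d) = (of_int (c * b) :: rat)" by (simp add: field_simps)
  then have "a * d = c * b" by (simp only: of_int_eq_iff)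
  then have "d dvd b" using cop by (metis coprime_commute coprime_dvd_mult_right_iff dvd_triv_right)
  then have "\<not> int p dvd d" using assms dvd_trans by blast
  then show ?thesis by (simp add: p_integral_def cd)
qed

lemma p_integralE:
  assumes "p_integral p x"
  obtains a b where "x = of_int a / of_int b" "\<not> int p dvd b" "b \<noteq> 0" "coprime a b"
    "quotient_of x = (a, b)"
proof -
  obtain a b where ab: "quotient_of x = (a, b)" by fastforce
  show ?thesis
    by (rule that[of a b])
      (use assms ab quotient_of_div[OF ab] quotient_of_coprime[OF ab] in \<open>auto simp: p_integral_def\<close>)
qed

lemma p_not_dvd_mult: "\<not> int p dvd a \<Longrightarrow> \<not> int p dvd b \<Longrightarrow> \<not> int p dvd a * b"
  using prime_p by (simp add: prime_dvd_mult_iff)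

lemma p_integral_add: "p_integral p x \<Longrightarrow> p_integral p y \<Longrightarrow> p_integral p (x + y)"
proof (elim p_integralE)
  fix a b c d
  assume *: "x = of_int a / of_int b" "\<not> int p dvd b" "b \<noteq> 0"
    "y = of_int c / of_int d" "\<not> int p dvd d" "d \<noteq> 0"
  have "x + y = of_int (a * d + c * b) / of_int (b * d)" using * by (simp add: field_simps)
  then show ?thesis using * p_integral_fractionI p_not_dvd_mult by metis
qed

lemma p_integral_mult: "p_integral p x \<Longrightarrow> p_integral p y \<Longrightarrow> p_integral p (x * y)"
proof (elim p_integralE)
  fix a b c d
  assume *: "x = of_int a / of_int b" "\<not> int p dvd b" "b \<noteq> 0"
    "y = of_int c / of_int d" "\<not> int p dvd d" "d \<noteq> 0"
  have "x * y = of_int (a * c) / of_int (b * d)" using * by (simp add: field_simps)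
  then show ?thesis using * p_integral_fractionI p_not_dvd_mult by metis
qed

lemma p_integral_of_int: "p_integral p (of_int a)"
  using p_integral_fractionI[of 1 a] prime_p by (auto simp: zdvd1_eq dest: prime_gt_1_nat)

lemma ideal_0_iff: "x \<in> I 0 \<longleftrightarrow> p_integral p x"
  by (simp add: padic_ideal_def)

lemma ideal_add: "x \<in> I k \<Longrightarrow> y \<in> I k \<Longrightarrow> x + y \<in> I k"
  unfolding padic_ideal_def by (simp add: add_divide_distrib p_integral_add)

lemma ideal_mult: "x \<in> I k \<Longrightarrow> y \<in> I l \<Longrightarrow> x * y \<in> I (k + l)"
  unfolding padic_ideal_def using p_integral_mult[of "x / of_nat p ^ k" "y / of_nat p ^ l"]
  by (simp add: power_add)

lemma ideal_of_int: "of_int a \<in> I 0"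
  by (simp add: ideal_0_iff p_integral_of_int)

lemma ideal_of_nat: "of_nat a \<in> I 0"
  using ideal_of_int[of "int a"] by simp

lemma ideal_numeral: "0 \<in> I 0" "1 \<in> I 0" "numeral a \<in> I 0"
  using ideal_of_int[of 0] ideal_of_int[of 1] ideal_of_int[of "numeral a"] by simp_all

lemma ideal_power_p: "of_nat p ^ k \<in> I k"
  using prime_p ideal_numeral(2) by (auto simp: padic_ideal_def dest: prime_gt_0_nat)

lemma ideal_p: "of_nat p \<in> I 1"
  using ideal_power_p[of 1] by simp

lemma ideal_mult_left: "x \<in> I 0 \<Longrightarrow> y \<in> I k \<Longrightarrow> x * y \<in> I k"
  using ideal_mult[of x 0 y k] by simp

lemma ideal_mult_right: "x \<in> I k \<Longrightarrow> y \<in> I 0 \<Longrightarrow> x * y \<in> I k"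
  using ideal_mult[of x k y 0] by simp

lemma ideal_uminus: "x \<in> I k \<Longrightarrow> - x \<in> I k"
  using ideal_mult_left[OF ideal_of_int[of "-1"]] by simp

lemma ideal_diff: "x \<in> I k \<Longrightarrow> y \<in> I k \<Longrightarrow> x - y \<in> I k"
  using ideal_add[of x k "- y"] ideal_uminus by simp

lemma ideal_zero: "0 \<in> I k"
  using ideal_mult_left[OF ideal_numeral(1) ideal_power_p] by simp

lemma ideal_sum: "(\<And>i. i \<in> S \<Longrightarrow> f i \<in> I k) \<Longrightarrow> sum f S \<in> I k"
  by (induction S rule: infinite_finite_induct) (auto intro: ideal_zero ideal_add)

lemma ideal_power_0: "x \<in> I 0 \<Longrightarrow> x ^ m \<in> I 0"
  by (induction m) (auto intro: ideal_numeral ideal_mult_left)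

lemma ideal_add_exponent_iff: "of_nat p ^ d * x \<in> I (d + k) \<longleftrightarrow> x \<in> I k"
  using prime_p by (auto simp: padic_ideal_def power_add dest: prime_gt_0_nat)

lemma ideal_mono: "x \<in> I k \<Longrightarrow> l \<le> k \<Longrightarrow> x \<in> I l"
proof -
  assume x: "x \<in> I k" and "l \<le> k"
  then obtain d where k: "k = d + l" using le_Suc_ex add.commute by metis
  have "of_nat p ^ d * (x / of_nat p ^ d) \<in> I k"
    using x prime_p by (auto dest: prime_gt_0_nat)
  then have "x / of_nat p ^ d \<in> I l" unfolding k ideal_add_exponent_iff .
  then have "of_nat p ^ d * (x / of_nat p ^ d) \<in> I l"
    by (intro ideal_mult_left ideal_power_0 ideal_of_nat)
  then show "x \<in> I l" using prime_p by (auto dest: prime_gt_0_nat)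
qed

lemma ideal_1_fraction_iff:
  assumes "\<not> int p dvd b"
  shows "of_int a / of_int b \<in> I 1 \<longleftrightarrow> int p dvd a"
proof
  have b: "b \<noteq> 0" using assms by auto
  have p: "p > 0" using prime_p by (rule prime_gt_0_nat)
  show "int p dvd a" if "of_int a / of_int b \<in> I 1"
  proof -
    from that have "p_integral p (of_int a / of_int b / of_nat p)" by (simp add: padic_ideal_def)
    then obtain c d where eq: "of_int a / of_int b / of_nat p = (of_int c / of_int d :: rat)"
      and d: "\<not> int p dvd d" "d \<noteq> 0" by (elim p_integralE)
    then have "of_int (a * d) = (of_int (int p * (c * b)) :: rat)"
      using b p by (simp add: field_simps)
    then have "a * d = int p * (c * b)" by (simp only: of_int_eq_iff)
    then show ?thesis using d(1) prime_p by (metis dvd_triv_left prime_dvd_mult_iff prime_nat_int_transfer)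
  qed
  show "of_int a / of_int b \<in> I 1" if "int p dvd a"
  proof -
    from that obtain c where "a = int p * c" by blast
    then show ?thesis
      using p assms by (simp add: padic_ideal_def p_integral_fractionI)
  qed
qed

lemma ideal_1_iff_numerator:
  assumes "x \<in> I 0"
  shows "x \<in> I 1 \<longleftrightarrow> int p dvd fst (quotient_of x)"
  using assms unfolding ideal_0_iff by (elim p_integralE) (simp add: ideal_1_fraction_iff del: One_nat_def)

text \<open>In the local ring, everything outside the maximal ideal \<open>I 1\<close> is a
  unit.\<close>

lemma ideal_inverse:
  assumes "u \<in> I 0" "u \<notin> I 1"
  shows "1 / u \<in> I 0"
proof -
  obtain a b where u: "u = of_int a / of_int b" "\<not> int p dvd b"
    using assms(1) unfolding ideal_0_iff by (elim p_integralE)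
  then have "\<not> int p dvd a" using assms(2) ideal_1_fraction_iff by simp
  then show ?thesis using p_integral_fractionI[of a b] u by (simp add: ideal_0_iff)
qed

lemma ideal_cancel_unit:
  assumes "u \<in> I 0" "u \<notin> I 1" "u * x \<in> I k"
  shows "x \<in> I k"
proof -
  have "u \<noteq> 0" using assms(2) ideal_zero by auto
  then show ?thesis using ideal_mult_left[OF ideal_inverse[OF assms(1,2)] assms(3)] by simp
qed

lemma ideal_1_of_int_iff: "of_int a \<in> I 1 \<longleftrightarrow> int p dvd a"
  using ideal_1_fraction_iff[of 1 a] prime_gt_1_nat[OF prime_p] by simp

lemma of_nat_notin_ideal_1: "0 < k \<Longrightarrow> k < p \<Longrightarrow> of_nat k \<notin> I 1"
  using ideal_1_of_int_iff[of "int k"] by (simp add: nat_dvd_not_less del: One_nat_def)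

lemma ideal_inverse_of_nat: "0 < k \<Longrightarrow> k < p \<Longrightarrow> 1 / of_nat k \<in> I 0"
  by (intro ideal_inverse ideal_of_nat of_nat_notin_ideal_1)

lemma ideal_cancel_of_nat:
  assumes "0 < m" "m < p" "of_nat m * x \<in> I k"
  shows "x \<in> I k"
  using assms ideal_cancel_unit ideal_of_nat of_nat_notin_ideal_1 by blast

lemma ideal_cong_mem: "x - y \<in> I k \<Longrightarrow> y \<in> I k \<Longrightarrow> x \<in> I k"
  using ideal_add by fastforce

lemma unit_cong_1:
  assumes "u - 1 \<in> I 1"
  shows "u \<in> I 0" "u \<notin> I 1"
proof -
  show "u \<in> I 0" using ideal_add[OF ideal_mono[OF assms] ideal_numeral(2)] by simp
  show "u \<notin> I 1"
  proof
    assume "u \<in> I 1"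
    then have "1 \<in> I 1" using ideal_diff[OF _ assms] by fastforce
    then show False using of_nat_notin_ideal_1[of 1] prime_gt_1_nat[OF prime_p] by simp
  qed
qed

lemmas ideal_intros = ideal_add ideal_diff ideal_uminus ideal_mult_left ideal_sum ideal_of_nat ideal_of_int
  ideal_numeral ideal_power_0 ideal_zero

section \<open>Power sums modulo \<open>p\<close>\<close>

text \<open>The Bernoulli recursion determines \<open>bernoulli m\<close> from smaller indices after
  division by \<open>Suc m\<close>, which is a unit since \<open>m + 1 < p\<close>.\<close>

lemma bernoulli_integral: "m + 1 < p \<Longrightarrow> bernoulli m \<in> I 0"
proof (induction m rule: less_induct)
  case (less m)
  \<comment> \<open>With upper bound 1 the power sum is just \<open>0 ^ m\<close>, and Faulhaber's
    formula becomes the recursion.\<close>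
  have "of_nat (Suc m) * (\<Sum>j<1. of_nat j ^ m :: rat)
     = (\<Sum>i\<le>m. of_nat (Suc m choose i) * bernoulli i)"
    using sum_powers_bernoulli[of m 1] by simp
  also have "{..m} = insert m {..<m}" by auto
  also have "(\<Sum>i\<in>insert m {..<m}. of_nat (Suc m choose i) * bernoulli i)
      = of_nat (Suc m) * bernoulli m + (\<Sum>i<m. of_nat (Suc m choose i) * bernoulli i)"
    by simp
  finally have "of_nat (Suc m) * bernoulli m
     = of_nat (Suc m) * of_nat (0 ^ m) - (\<Sum>i<m. of_nat (Suc m choose i) * bernoulli i)"
    by simp
  also have "\<dots> \<in> I 0"
    using less by (intro ideal_intros) auto
  finally show ?case
    by (rule ideal_cancel_of_nat[rotated 2]) (use less.prems in auto)
qed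

text \<open>In Faulhaber's formula with upper bound \<open>p\<close>, every term has a positive
  power of \<open>p\<close> and an integral Bernoulli number.\<close>

lemma power_sum_in_ideal_1:
  assumes "1 \<le> m" "m + 1 < p"
  shows "(\<Sum>k=1..p-1. of_nat k ^ m) \<in> I 1"
proof -
  have "of_nat (Suc m) * (\<Sum>j<p. of_nat j ^ m)
     = (\<Sum>i\<le>m. of_nat (Suc m choose i) * bernoulli i * of_nat p ^ (Suc m - i))"
    by (rule sum_powers_bernoulli)
  also have "\<dots> \<in> I 1"
    using assms
    by (intro ideal_sum ideal_mult_left ideal_of_nat bernoulli_integral ideal_mono[OF ideal_power_p]) auto
  finally have "(\<Sum>j<p. of_nat j ^ m) \<in> I 1"
    by (rule ideal_cancel_of_nat[rotated 2]) (use assms in auto)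
  \<comment> \<open>The extra term \<open>j = 0\<close> is \<open>0 ^ m\<close>, which vanishes
    because \<open>m\<close> is positive.\<close>
  moreover have "{..<p} = insert 0 {1..p-1}" using assms by auto
  ultimately show ?thesis using assms by (simp add: power_0_left)
qed

lemma fermat_ideal:
  assumes "0 < k" "k < p"
  shows "of_nat k ^ (p - 1) - 1 \<in> I 1"
proof -
  have "\<not> p dvd k" using assms by (simp add: nat_dvd_not_less)
  then have "[k ^ (p - 1) = 1] (mod p)" by (rule fermat_theorem[OF prime_p])
  then have "int p dvd int k ^ (p - 1) - 1"
    by (metis cong_iff_dvd_diff cong_int_iff of_nat_1 of_nat_power)
  then show ?thesis using ideal_1_of_int_iff[of "int k ^ (p - 1) - 1"] by simp
qed

text \<open>Fermat's theorem trades negative powers for positive ones, to which Faulhaber's formula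
  applies.\<close>

lemma inverse_power_cong:
  assumes "0 < k" "k < p" "m \<le> p - 1"
  shows "(1 / of_nat k) ^ m - of_nat k ^ (p - 1 - m) \<in> I 1"
proof -
  have "of_nat k ^ (p - 1) = (of_nat k ^ (p - 1 - m) * of_nat k ^ m :: rat)"
    using assms by (simp flip: power_add)
  then have "(1 / of_nat k) ^ m - of_nat k ^ (p - 1 - m)
      = - ((1 / of_nat k) ^ m * (of_nat k ^ (p - 1) - 1 :: rat))"
    using assms by (simp add: field_simps)
  then show ?thesis
    using assms by (metis ideal_uminus ideal_mult_left ideal_power_0 ideal_inverse_of_nat fermat_ideal)
qed

lemma inverse_power_sum_in_ideal_1:
  assumes "1 \<le> m" "m + 1 < p"
  shows "(\<Sum>k=1..p-1. (1 / of_nat k) ^ m) \<in> I 1"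
proof -
  have "(\<Sum>k=1..p-1. (1 / of_nat k) ^ m - of_nat k ^ (p - 1 - m)) \<in> I 1"
    using assms by (intro ideal_sum inverse_power_cong) auto
  moreover have "(\<Sum>k=1..p-1. of_nat k ^ (p - 1 - m)) \<in> I 1"
    using assms by (intro power_sum_in_ideal_1) auto
  ultimately show ?thesis unfolding sum_subtractf by (rule ideal_cong_mem)
qed

lemma ideal_p_mult: "x \<in> I k \<Longrightarrow> of_nat p * x \<in> I (Suc k)"
  using ideal_mult[OF ideal_p] by simp

section \<open>Harmonic sums modulo powers of \<open>p\<close>\<close>

text \<open>Here \<open>e\<close> is the second elementary symmetric function of the
  \<open>a i\<close>, recorded through Newton's identity for \<open>2 * e\<close>. All further terms
  contain \<open>y ^ 3\<close>.\<close>

lemma prod_one_plus_expansion: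
  assumes p: "p > 2" and S: "finite S" and y: "y \<in> I j" and a: "\<And>i. i \<in> S \<Longrightarrow> a i \<in> I 0"
  shows "\<exists>e\<in>I 0. 2 * e = (\<Sum>i\<in>S. a i)\<^sup>2 - (\<Sum>i\<in>S. (a i)\<^sup>2)
           \<and> (\<Prod>i\<in>S. 1 + y * a i) - (1 + y * (\<Sum>i\<in>S. a i) + y\<^sup>2 * e) \<in> I (3 * j)"
  using S a
proof (induction S)
  case empty
  then show ?case by (auto intro!: bexI[of _ 0] ideal_zero)
next
  case (insert s S)
  define A where "A = (\<Sum>i\<in>S. a i)"
  define P where "P = (\<Prod>i\<in>S. 1 + y * a i)"
  obtain e where e: "e \<in> I 0" "2 * e = A\<^sup>2 - (\<Sum>i\<in>S. (a i)\<^sup>2)"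
    and P: "P - (1 + y * A + y\<^sup>2 * e) \<in> I (3 * j)"
    using insert unfolding A_def P_def by auto
  have s: "a s \<in> I 0" and A: "A \<in> I 0"
    using insert.prems by (auto simp: A_def intro: ideal_sum)
  have y0: "y \<in> I 0" using y by (rule ideal_mono) simp
  have y3: "y ^ 3 \<in> I (3 * j)"
    using ideal_mult[OF ideal_mult[OF y y] y] by (simp add: power3_eq_cube ac_simps mult_2 numeral_3_eq_3)
  \<comment> \<open>The new factor changes \<open>e\<close> into \<open>e + a s * A\<close>; the
    only new error is the cubic term \<open>a s * e * y ^ 3\<close>.\<close>
  have "(1 + y * a s) * P - (1 + y * (a s + A) + y\<^sup>2 * (e + a s * A))
      = (1 + y * a s) * (P - (1 + y * A + y\<^sup>2 * e)) + (a s * e) * y ^ 3"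
    by (simp add: algebra_simps power2_eq_square power3_eq_cube)
  also have "\<dots> \<in> I (3 * j)"
    by (intro ideal_intros P y3 y0 s e)
  finally have 1: "(1 + y * a s) * P - (1 + y * (a s + A) + y\<^sup>2 * (e + a s * A)) \<in> I (3 * j)" .
  have 2: "2 * (e + a s * A) = (a s + A)\<^sup>2 - ((a s)\<^sup>2 + (\<Sum>i\<in>S. (a i)\<^sup>2))"
    using e(2) by (simp add: algebra_simps power2_eq_square)
  have "e + a s * A \<in> I 0" by (intro ideal_intros e s A)
  then show ?case
    using 1 2 insert.hyps unfolding A_def P_def by (intro bexI[of _ "e + a s * A"]) (auto simp: A_def)
qed

lemma harmonic_reflection:
  "2 * H1 (p - 1) = of_nat p * (\<Sum>k=1..p-1. 1 / (of_nat k * of_nat (p - k)))"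
proof -
  have "H1 (p - 1) = (\<Sum>k=1..p-1. 1 / of_nat (p - k))"
    unfolding H1_def by (subst sum.atLeastAtMost_rev) (use prime_gt_0_nat[OF prime_p] in simp)
  then have "2 * H1 (p - 1) = (\<Sum>k=1..p-1. 1 / of_nat k + 1 / of_nat (p - k))"
    by (simp add: sum.distrib H1_def)
  also have "\<dots> = (\<Sum>k=1..p-1. of_nat p * (1 / (of_nat k * of_nat (p - k))))"
    by (intro sum.cong refl) (auto simp: field_simps of_nat_diff)
  finally show ?thesis by (simp add: sum_distrib_left)
qed

text \<open>Expanding \<open>1 / (p - k)\<close> geometrically in \<open>p / k\<close> with exact
  remainder turns the reflected sum into the negated square sum, a cubic term and a term in
  \<open>p ^ 2\<close>. Since the cubic sum is itself divisible by \<open>p\<close>, only the square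
  sum survives.\<close>

lemma harmonic_cong_square_sum:
  assumes "p \<ge> 7"
  shows "2 * H1 (p - 1) + of_nat p * (\<Sum>k=1..p-1. (1 / of_nat k)\<^sup>2) \<in> I 3"
proof -
  have term_eq: "1 / (of_nat k * of_nat (p - k))
     = of_nat p * (of_nat p * ((1 / of_nat k) ^ 3 * (1 / of_nat (p - k))))
       - (1 / of_nat k)\<^sup>2 - of_nat p * (1 / of_nat k :: rat) ^ 3" (is "_ = ?t k") if "k \<in> {1..p-1}" for k
  proof -
    obtain x y :: rat where x: "x = of_nat k" and y: "y = of_nat (p - k)" by blast
    have "of_nat p = x + y" "x \<noteq> 0" "y \<noteq> 0" using that by (auto simp: x y of_nat_diff)
    then show ?thesis unfolding x[symmetric] y[symmetric]
      by (simp add: divide_simps) (simp add: algebra_simps eval_nat_numeral)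
  qed
  let ?Z = "\<Sum>k=1..p-1. (1 / of_nat k) ^ 3 * (1 / of_nat (p - k)) :: rat"
  let ?T = "\<Sum>k=1..p-1. (1 / of_nat k) ^ 3 :: rat"
  have "(\<Sum>k=1..p-1. 1 / (of_nat k * of_nat (p - k))) = (\<Sum>k=1..p-1. ?t k)"
    by (rule sum.cong[OF refl term_eq])
  also have "\<dots> = of_nat p * (of_nat p * ?Z) - (\<Sum>k=1..p-1. (1 / of_nat k)\<^sup>2) - of_nat p * ?T"
    by (simp only: sum_subtractf sum_distrib_left)
  finally have "2 * H1 (p - 1) + of_nat p * (\<Sum>k=1..p-1. (1 / of_nat k)\<^sup>2)
     = of_nat p * (of_nat p * (of_nat p * ?Z)) - of_nat p * (of_nat p * ?T)"
    by (simp only: harmonic_reflection) (simp only: algebra_simps)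
  also have "\<dots> \<in> I (Suc (Suc (Suc 0)))"
  proof (intro ideal_diff ideal_p_mult)
    show "?Z \<in> I 0"
      by (intro ideal_sum ideal_mult_left ideal_power_0 ideal_inverse_of_nat) auto
    show "?T \<in> I (Suc 0)"
      using inverse_power_sum_in_ideal_1[of 3] assms by simp
  qed
  finally show ?thesis by (simp add: numeral_3_eq_3)
qed

text \<open>The square sum is divisible by \<open>p\<close>, so the preceding congruence puts
  \<open>2 * H1 (p - 1)\<close> into \<open>I 2\<close>, and 2 is a unit.\<close>

lemma wolstenholme:
  assumes "p \<ge> 7"
  shows "H1 (p - 1) \<in> I 2"
proof -
  have "of_nat p * (\<Sum>k=1..p-1. (1 / of_nat k)\<^sup>2) \<in> I 2"
    using ideal_p_mult[OF inverse_power_sum_in_ideal_1[of 2]] assms by (simp add: numeral_2_eq_2)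
  then have "2 * H1 (p - 1) + of_nat p * (\<Sum>k=1..p-1. (1 / of_nat k)\<^sup>2)
      - of_nat p * (\<Sum>k=1..p-1. (1 / of_nat k)\<^sup>2) \<in> I 2"
    using ideal_mono[OF harmonic_cong_square_sum[OF assms], of 2] by (intro ideal_diff) auto
  then have "of_nat 2 * H1 (p - 1) \<in> I 2" by simp
  then show ?thesis by (rule ideal_cancel_of_nat[rotated 2]) (use assms in auto)
qed

text \<open>In the alternating identity for \<open>n = p\<close>, absorption gives each term a
  factor \<open>p\<close>; hence the signed binomial coefficients \<open>D k\<close> are needed only
  modulo \<open>p ^ 2\<close>, where they are \<open>1 - p * H1 (k - 1)\<close>.\<close>

lemma harmonic_double_sum:
  assumes "p \<ge> 7"
  shows "of_nat p * (\<Sum>k=1..p-1. (1 / of_nat k)\<^sup>2)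
    - of_nat p ^ 2 * (\<Sum>k=1..p-1. (1 / of_nat k)\<^sup>2 * H1 (k - 1)) - H1 (p - 1) \<in> I 3"
proof -
  define D where "D k = (\<Prod>j=1..k-1. 1 - of_nat p / of_nat j :: rat)" for k
  have D: "D k - (1 - of_nat p * H1 (k - 1)) \<in> I 2" if "k \<in> {1..p-1}" for k
  proof -
    have "- of_nat p \<in> I 1" using ideal_p by (rule ideal_uminus)
    then have "\<exists>e\<in>I 0. 2 * e = (\<Sum>j=1..k-1. 1 / of_nat j)\<^sup>2 - (\<Sum>j=1..k-1. (1 / of_nat j)\<^sup>2)
        \<and> (\<Prod>j=1..k-1. 1 + - of_nat p * (1 / of_nat j))
          - (1 + - of_nat p * (\<Sum>j=1..k-1. 1 / of_nat j) + (- of_nat p)\<^sup>2 * e) \<in> I (3 * 1)"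
      using assms that by (intro prod_one_plus_expansion ideal_inverse_of_nat) auto
    then obtain e where e: "e \<in> I 0" "(\<Prod>j=1..k-1. 1 + - of_nat p * (1 / of_nat j))
        - (1 + - of_nat p * (\<Sum>j=1..k-1. 1 / of_nat j) + (- of_nat p)\<^sup>2 * e) \<in> I (3 * 1)"
      by blast
    then have "D k - (1 - of_nat p * H1 (k - 1) + of_nat p ^ 2 * e) \<in> I 2"
      by (auto simp: D_def H1_def intro: ideal_mono)
    moreover have "of_nat p ^ 2 * e \<in> I 2" using ideal_power_p e(1) by (rule ideal_mult_right)
    ultimately have "D k - (1 - of_nat p * H1 (k - 1) + of_nat p ^ 2 * e) + of_nat p ^ 2 * e \<in> I 2"
      by (rule ideal_add)
    also have "D k - (1 - of_nat p * H1 (k - 1) + of_nat p ^ 2 * e) + of_nat p ^ 2 * e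
        = D k - (1 - of_nat p * H1 (k - 1))"
      by (simp only: algebra_simps)
    finally show ?thesis .
  qed
  \<comment> \<open>The term \<open>k = p\<close> is \<open>1 / p\<close> because \<open>p\<close>
    is odd; it cancels the last summand of \<open>H1 p\<close>.\<close>
  have p: "{1..p} = insert p {1..p-1}" "p \<noteq> 0" using assms by auto
  have "odd p" using assms prime_p prime_odd_nat by auto
  then have "(-1) ^ (p - 1) = (1 :: rat)" using assms by simp
  moreover have "H1 p = 1 / of_nat p + H1 (p - 1)" unfolding H1_def p(1) using p(2) by simp
  ultimately have "H1 (p - 1) = (\<Sum>k=1..p-1. (-1) ^ (k - 1) * of_nat (p choose k) / of_nat k)"
    using alternating_binomial_harmonic[of p] p by simp
  also have "\<dots> = (\<Sum>k=1..p-1. of_nat p * ((1 / of_nat k)\<^sup>2 * D k))"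
  proof (intro sum.cong refl)
    fix k assume k: "k \<in> {1..p-1}"
    have "k * (p choose k) = p * ((p - 1) choose (k - 1))"
      using k by (intro times_binomial_minus1_eq) auto
    then have "of_nat k * of_nat (p choose k) = (of_nat p * of_nat ((p - 1) choose (k - 1)) :: rat)"
      by (metis of_nat_mult)
    then have "of_nat (p choose k) = (of_nat p / of_nat k * of_nat ((p - 1) choose (k - 1)) :: rat)"
      using k by (simp add: field_simps)
    moreover have "D k = (-1) ^ (k - 1) * of_nat ((p - 1) choose (k - 1))"
      unfolding D_def using k by (subst signed_binomial_eq_prod) auto
    ultimately show "(-1) ^ (k - 1) * of_nat (p choose k) / of_nat k
        = of_nat p * ((1 / of_nat k)\<^sup>2 * D k)"
      by (simp add: power2_eq_square)
  qed
  finally have "of_nat p * (\<Sum>k=1..p-1. (1 / of_nat k)\<^sup>2)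
    - of_nat p ^ 2 * (\<Sum>k=1..p-1. (1 / of_nat k)\<^sup>2 * H1 (k - 1)) - H1 (p - 1)
    = - (of_nat p * (\<Sum>k=1..p-1. (1 / of_nat k)\<^sup>2 * (D k - (1 - of_nat p * H1 (k - 1)))))"
    by (simp add: sum_distrib_left sum_subtractf sum.distrib algebra_simps power2_eq_square)
  also have "\<dots> \<in> I (Suc 2)"
    by (intro ideal_uminus ideal_p_mult ideal_sum ideal_mult_left D ideal_power_0 ideal_inverse_of_nat)
      auto
  finally show ?thesis by simp
qed

text \<open>After Fermat and Faulhaber, the sum over \<open>k\<close> runs over powers with exponent
  \<open>p - 3 - i\<close>. These sums vanish modulo \<open>p\<close> except for
  \<open>i = p - 3\<close>, where the exponent is 0.\<close>

lemma double_sum_cong_bernoulli: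
  assumes "p \<ge> 7"
  shows "(\<Sum>k=1..p-1. (1 / of_nat k)\<^sup>2 * H1 (k - 1)) - bernoulli (p - 3) \<in> I 1"
proof -
  let ?X = "\<Sum>k=1..p-1. (1 / of_nat k)\<^sup>2 * H1 (k - 1) :: rat"
  define Y where "Y = (\<Sum>k=1..p-1. (1 / of_nat k)\<^sup>2 * (\<Sum>j<k. of_nat j ^ (p - 2)) :: rat)"
  have XY: "?X - Y \<in> I 1"
  proof -
    have "H1 (k - 1) - (\<Sum>j<k. of_nat j ^ (p - 2)) \<in> I 1" if "k \<in> {1..p-1}" for k
    proof -
      have "{..<k} = insert 0 {1..k-1}" using that by auto
      then have "(\<Sum>j<k. of_nat j ^ (p - 2)) = (\<Sum>j=1..k-1. of_nat j ^ (p - 2) :: rat)"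
        using assms by simp
      moreover have "(\<Sum>j=1..k-1. (1 / of_nat j) ^ 1 - of_nat j ^ (p - 1 - 1)) \<in> I 1"
        using that assms by (intro ideal_sum inverse_power_cong) auto
      ultimately show ?thesis by (simp add: H1_def sum_subtractf numeral_2_eq_2)
    qed
    then have "(\<Sum>k=1..p-1. (1 / of_nat k)\<^sup>2 * (H1 (k - 1) - (\<Sum>j<k. of_nat j ^ (p - 2)))) \<in> I 1"
      by (intro ideal_sum ideal_mult_left ideal_power_0 ideal_inverse_of_nat) auto
    then show ?thesis by (simp add: Y_def right_diff_distrib sum_subtractf)
  qed
  define c where "c i = of_nat ((p - 1) choose i) * bernoulli i" for i
  define s where "s i = (\<Sum>k=1..p-1. (1 / of_nat k)\<^sup>2 * of_nat k ^ (p - 1 - i) :: rat)" for i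
  have p2: "Suc (p - 2) = p - 1" using assms by simp
  have "of_nat (p - 1) * Y
      = (\<Sum>k=1..p-1. (1 / of_nat k)\<^sup>2 * (of_nat (p - 1) * (\<Sum>j<k. of_nat j ^ (p - 2))))"
    by (simp add: Y_def sum_distrib_left algebra_simps)
  also have "\<dots> = (\<Sum>k=1..p-1. (1 / of_nat k)\<^sup>2 * (\<Sum>i\<le>p-2. c i * of_nat k ^ (p - 1 - i)))"
    using sum_powers_bernoulli[of "p - 2"] by (simp add: p2 c_def)
  also have "\<dots> = (\<Sum>k=1..p-1. \<Sum>i\<le>p-2. c i * ((1 / of_nat k)\<^sup>2 * of_nat k ^ (p - 1 - i)))"
    by (simp add: sum_distrib_left algebra_simps)
  also have "\<dots> = (\<Sum>i\<le>p-2. c i * s i)"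
    unfolding s_def by (subst sum.swap) (simp add: sum_distrib_left)
  also have "{..p-2} = insert (p - 3) ({..p-2} - {p-3})" using assms by auto
  also have "(\<Sum>i\<in>insert (p - 3) ({..p-2} - {p-3}). c i * s i)
      = c (p - 3) * s (p - 3) + (\<Sum>i\<in>{..p-2} - {p-3}. c i * s i)"
    by (rule sum.insert) auto
  also have "s (p - 3) = of_nat (p - 1)"
    using assms by (simp add: s_def power_one_over)
  \<comment> \<open>The factor \<open>p - 1\<close> from Faulhaber's formula matches the value of
    \<open>s (p - 3)\<close>, so it can be cancelled as a unit.\<close>
  finally have Y: "of_nat (p - 1) * (Y - c (p - 3)) = (\<Sum>i\<in>{..p-2} - {p-3}. c i * s i)"
    by (simp add: algebra_simps)
  have c: "c i \<in> I 0" if "i \<le> p - 2" for i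
    unfolding c_def using that assms by (intro ideal_mult_left ideal_of_nat bernoulli_integral) auto
  have s: "s i \<in> I 1" if i: "i \<le> p - 2" "i \<noteq> p - 3" for i
  \<comment> \<open>For \<open>i = p - 2\<close> the exponent is -1, a plain harmonic sum; for
    smaller \<open>i\<close> it is the positive number \<open>d = p - 3 - i\<close>.\<close>
  proof (cases "i = p - 2")
    case True
    then have "p - 1 - i = 1" using assms by simp
    then have "s i = (\<Sum>k=1..p-1. (1 / of_nat k) ^ 1)"
      unfolding s_def by (intro sum.cong refl) (simp add: power2_eq_square)
    then show ?thesis using inverse_power_sum_in_ideal_1[of 1] assms by simp
  next
    case False
    then obtain d where d: "p - 1 - i = 2 + d" "1 \<le> d" "d + 1 < p"
      using i assms by (intro that[of "p - 3 - i"]) auto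
    have "s i = (\<Sum>k=1..p-1. of_nat k ^ d)"
      unfolding s_def d(1) by (intro sum.cong refl) (simp add: power_add power2_eq_square)
    then show ?thesis using power_sum_in_ideal_1 d by simp
  qed
  have "of_nat (p - 1) * (Y - c (p - 3)) \<in> I 1"
    unfolding Y by (intro ideal_sum ideal_mult_left c s) auto
  then have Yc: "Y - c (p - 3) \<in> I 1"
    by (rule ideal_cancel_of_nat[rotated 2]) (use assms in auto)
  \<comment> \<open>The binomial coefficient is \<open>(p - 1) * (p - 2) / 2\<close>, which is 1
    modulo \<open>p\<close>; doubling avoids the division.\<close>
  have cB: "c (p - 3) - bernoulli (p - 3) \<in> I 1"
  proof -
    have "(p - 1) choose (p - 3) = (p - 1) choose 2"
      using assms by (subst binomial_symmetric) auto
    moreover have "p - 1 - 1 = p - 2" by simp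
    ultimately have "2 * ((p - 1) choose (p - 3)) = (p - 1) * (p - 2)"
      by (simp only: choose_two) simp
    then have "of_nat 2 * of_nat ((p - 1) choose (p - 3)) = (of_nat (p - 1) * of_nat (p - 2) :: rat)"
      by (metis of_nat_mult)
    then have "of_nat 2 * of_nat ((p - 1) choose (p - 3)) - 2 = (of_nat p * (of_nat p - 3) :: rat)"
      using assms by (simp add: of_nat_diff algebra_simps)
    moreover have "of_nat 2 * (c (p - 3) - bernoulli (p - 3))
        = (of_nat 2 * of_nat ((p - 1) choose (p - 3)) - 2) * bernoulli (p - 3)"
      by (simp add: c_def algebra_simps)
    ultimately have "of_nat 2 * (c (p - 3) - bernoulli (p - 3))
        = of_nat p * ((of_nat p - 3) * bernoulli (p - 3))"
      by simp
    also have "\<dots> \<in> I (Suc 0)"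
      using assms by (intro ideal_p_mult ideal_mult_left ideal_intros bernoulli_integral) auto
    finally show ?thesis
      using ideal_cancel_of_nat[of 2 _ 1] assms by simp
  qed
  have "(?X - Y) + (Y - c (p - 3)) + (c (p - 3) - bernoulli (p - 3)) \<in> I 1"
    by (intro ideal_add XY Yc cB)
  then show ?thesis by simp
qed

text \<open>Subtracting the two congruences modulo \<open>p ^ 3\<close> eliminates the square sum;
  dividing by \<open>p ^ 2\<close> leaves a congruence modulo \<open>p\<close>.\<close>

lemma wolstenholme_quotient_bernoulli:
  assumes "p \<ge> 7"
  shows "3 * (H1 (p - 1) / of_nat p ^ 2) + bernoulli (p - 3) \<in> I 1"
proof -
  let ?X = "\<Sum>k=1..p-1. (1 / of_nat k)\<^sup>2 * H1 (k - 1) :: rat"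
  have "of_nat p ^ 2 * (3 * (H1 (p - 1) / of_nat p ^ 2) + ?X) = 3 * H1 (p - 1) + of_nat p ^ 2 * ?X"
    using assms by (simp add: field_simps)
  also have "\<dots> = (2 * H1 (p - 1) + of_nat p * (\<Sum>k=1..p-1. (1 / of_nat k)\<^sup>2))
     - (of_nat p * (\<Sum>k=1..p-1. (1 / of_nat k)\<^sup>2) - of_nat p ^ 2 * ?X - H1 (p - 1))"
    by simp
  also have "\<dots> \<in> I (2 + 1)"
    using ideal_diff[OF harmonic_cong_square_sum harmonic_double_sum] assms by simp
  finally have "3 * (H1 (p - 1) / of_nat p ^ 2) + ?X \<in> I 1"
    unfolding ideal_add_exponent_iff .
  from ideal_diff[OF this double_sum_cong_bernoulli[OF assms]] show ?thesis by simp
qed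

section \<open>Row quotients modulo \<open>p ^ 5\<close>\<close>

lemma prod_cong_1: "(\<And>i. i \<in> S \<Longrightarrow> f i - 1 \<in> I 1) \<Longrightarrow> prod f S - 1 \<in> I 1"
proof (induction S rule: infinite_finite_induct)
  case (insert s S)
  have "f s - 1 \<in> I 1" "prod f S - 1 \<in> I 1" using insert by auto
  then have "f s * (prod f S - 1) + (f s - 1) \<in> I 1"
    by (intro ideal_add ideal_mult_left unit_cong_1)
  then show ?case using insert.hyps by (simp add: algebra_simps)
qed (auto intro: ideal_zero)

lemma row_quotient_cong_1: "row_quotient p m - 1 \<in> I 1"
  unfolding row_quotient_def
proof (rule prod_cong_1)
  fix k assume "k \<in> {1..p-1}"
  then have "(of_nat m * (1 / of_nat k)) * of_nat p \<in> I 1"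
    by (intro ideal_mult_left ideal_of_nat ideal_inverse_of_nat ideal_p) auto
  then show "1 + of_nat m * of_nat p / of_nat k - 1 \<in> I 1" by simp
qed

text \<open>Multiplying the product by its reversal pairs \<open>k\<close> with
  \<open>p - k\<close>. As \<open>1 / k + 1 / (p - k)\<close> has a factor \<open>p\<close>, each
  paired factor differs from 1 only by a multiple of \<open>p ^ 2\<close>.\<close>

lemma row_quotient_square:
  "(row_quotient p m)\<^sup>2 = (\<Prod>k=1..p-1. 1 + of_nat m * (of_nat m + 1) * of_nat p ^ 2
      * (1 / (of_nat k * of_nat (p - k))))"
proof -
  have "row_quotient p m = (\<Prod>k=1..p-1. 1 + of_nat m * of_nat p / of_nat (p - k))"
    unfolding row_quotient_def
    by (subst prod.atLeastAtMost_rev) (use prime_gt_0_nat[OF prime_p] in simp)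
  then have "(row_quotient p m)\<^sup>2 = (\<Prod>k=1..p-1. (1 + of_nat m * of_nat p / of_nat k)
      * (1 + of_nat m * of_nat p / of_nat (p - k)))"
    by (simp add: prod.distrib row_quotient_def power2_eq_square)
  also have "\<dots> = (\<Prod>k=1..p-1. 1 + of_nat m * (of_nat m + 1) * of_nat p ^ 2
      * (1 / (of_nat k * of_nat (p - k))))"
  proof (intro prod.cong refl)
    fix k assume k: "k \<in> {1..p-1}"
    obtain x y :: rat where x: "x = of_nat k" and y: "y = of_nat (p - k)" by blast
    have "of_nat p = x + y" "x \<noteq> 0" "y \<noteq> 0" using k by (auto simp: x y of_nat_diff)
    then show "(1 + of_nat m * of_nat p / of_nat k) * (1 + of_nat m * of_nat p / of_nat (p - k))
      = 1 + of_nat m * (of_nat m + 1) * of_nat p ^ 2 * (1 / (of_nat k * of_nat (p - k)) :: rat)"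
      unfolding x[symmetric] y[symmetric]
      by (simp add: divide_simps) (simp add: algebra_simps eval_nat_numeral)
  qed
  finally show ?thesis .
qed

lemma wolstenholme_quotient_integral:
  assumes "p \<ge> 7"
  shows "H1 (p - 1) / of_nat p ^ 2 \<in> I 0"
  using wolstenholme[OF assms] by (simp add: padic_ideal_def)

text \<open>Modulo \<open>p\<close>, \<open>p - k\<close> is \<open>- k\<close>, so the terms become
  inverse fourth powers.\<close>

lemma square_reflected_sum:
  assumes "p \<ge> 7"
  shows "(\<Sum>k=1..p-1. (1 / (of_nat k * of_nat (p - k)))\<^sup>2) \<in> I 1"
proof (rule ideal_cong_mem)
  show "(\<Sum>k=1..p-1. (1 / of_nat k) ^ 4) \<in> I 1"
    using assms by (intro inverse_power_sum_in_ideal_1) auto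
  have "(1 / (of_nat k * of_nat (p - k)))\<^sup>2 - (1 / of_nat k) ^ 4 \<in> I 1" if k: "k \<in> {1..p-1}" for k
  proof -
    obtain x y :: rat where x: "x = of_nat k" and y: "y = of_nat (p - k)" by blast
    have *: "of_nat p = x + y" "x \<noteq> 0" "y \<noteq> 0" using k by (auto simp: x y of_nat_diff)
    have "1 / x \<in> I 0" "1 / y \<in> I 0"
      unfolding x y using k by (auto intro!: ideal_inverse_of_nat)
    \<comment> \<open>This product exhibits the difference as an explicit integral cofactor times
      \<open>p = x + y\<close>.\<close>
    then have "((1 / x) * (1 / y) - (1 / x)\<^sup>2) * ((1 / x)\<^sup>2 * (1 / y)) * of_nat p \<in> I 1"
      by (intro ideal_mult_left ideal_diff ideal_power_0 ideal_p)
    also have "((1 / x) * (1 / y) - (1 / x)\<^sup>2) * ((1 / x)\<^sup>2 * (1 / y)) * of_nat p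
        = (1 / (x * y))\<^sup>2 - (1 / x) ^ 4"
      using * by (simp add: divide_simps) (simp add: algebra_simps eval_nat_numeral)
    finally show ?thesis unfolding x y .
  qed
  then show "(\<Sum>k=1..p-1. (1 / (of_nat k * of_nat (p - k)))\<^sup>2) - (\<Sum>k=1..p-1. (1 / of_nat k) ^ 4) \<in> I 1"
    unfolding sum_subtractf[symmetric] by (rule ideal_sum)
qed

text \<open>The square is \<open>1 + 2 * u\<close>, hence \<open>(1 + u)\<^sup>2\<close>, modulo
  \<open>p ^ 5\<close>. The root is extracted by factoring the difference of squares, whose other
  factor is 2 modulo \<open>p\<close>.\<close>

lemma row_quotient_cong:
  assumes "p \<ge> 7"
  shows "row_quotient p m
    - (1 + of_nat p ^ 3 * (H1 (p - 1) / of_nat p ^ 2) * (of_nat m * (of_nat m + 1))) \<in> I 5"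
proof -
  define W where "W = H1 (p - 1) / of_nat p ^ 2"
  define u where "u = of_nat p ^ 3 * W * (of_nat m * (of_nat m + 1))"
  define y where "y = of_nat m * (of_nat m + 1) * (of_nat p ^ 2 :: rat)"
  define a where "a k = 1 / (of_nat k * of_nat (p - k) :: rat)" for k
  let ?F = "row_quotient p m"
  have W: "W \<in> I 0" unfolding W_def by (rule wolstenholme_quotient_integral[OF assms])
  have u: "u \<in> I 3" unfolding u_def
    by (intro ideal_mult_right ideal_power_p ideal_intros W)
  have y: "y \<in> I 2" unfolding y_def by (intro ideal_mult_left ideal_intros ideal_power_p)
  have A: "(\<Sum>k=1..p-1. a k) = of_nat p * (2 * W)"
    using harmonic_reflection assms by (simp add: W_def a_def field_simps power2_eq_square)
  have "\<exists>e\<in>I 0. 2 * e = (\<Sum>k=1..p-1. a k)\<^sup>2 - (\<Sum>k=1..p-1. (a k)\<^sup>2)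
      \<and> (\<Prod>k=1..p-1. 1 + y * a k) - (1 + y * (\<Sum>k=1..p-1. a k) + y\<^sup>2 * e) \<in> I (3 * 2)"
  proof (rule prod_one_plus_expansion)
    fix k assume "k \<in> {1..p-1}"
    then have "(1 / of_nat k) * (1 / of_nat (p - k)) \<in> I 0"
      by (intro ideal_mult_left ideal_inverse_of_nat) auto
    then show "a k \<in> I 0" by (simp add: a_def)
  qed (use assms y in auto)
  then obtain e where e: "2 * e = (of_nat p * (2 * W))\<^sup>2 - (\<Sum>k=1..p-1. (a k)\<^sup>2)"
    and P: "(\<Prod>k=1..p-1. 1 + y * a k) - (1 + y * (of_nat p * (2 * W)) + y\<^sup>2 * e) \<in> I (3 * 2)"
    unfolding A by blast
  have "of_nat 2 * e = (of_nat p * (2 * W * (of_nat p * (2 * W)))) - (\<Sum>k=1..p-1. (a k)\<^sup>2)"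
    using e by (simp add: power2_eq_square)
  also have "\<dots> \<in> I (Suc 0)"
    using square_reflected_sum[OF assms]
    by (intro ideal_diff ideal_p_mult ideal_mult_left ideal_numeral ideal_of_nat W) (simp_all add: a_def)
  \<comment> \<open>This extra factor \<open>p\<close> in \<open>e\<close> lifts
    \<open>y\<^sup>2 * e\<close> from \<open>I 4\<close> to \<open>I 5\<close>.\<close>
  finally have e1: "e \<in> I 1" using ideal_cancel_of_nat[of 2 e 1] assms by simp
  have "y\<^sup>2 * e \<in> I 5"
    using ideal_mult[OF ideal_mult[OF y y] e1] by (simp add: power2_eq_square)
  from ideal_add[OF ideal_mono[OF P, of 5] this]
  have "?F\<^sup>2 - (1 + y * (of_nat p * (2 * W))) \<in> I 5"
    unfolding row_quotient_square y_def a_def by (simp add: algebra_simps)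
  also have "y * (of_nat p * (2 * W)) = 2 * u"
    by (simp add: y_def u_def power2_eq_square power3_eq_cube)
  finally have sq: "?F\<^sup>2 - (1 + 2 * u) \<in> I 5" .
  have u2: "u\<^sup>2 \<in> I 5"
    using ideal_mono[OF ideal_mult[OF u u], of 5] by (simp add: power2_eq_square)
  have "(?F + 1 + u) * (?F - (1 + u)) = ?F\<^sup>2 - (1 + 2 * u) - u\<^sup>2"
    by (simp add: algebra_simps power2_eq_square)
  then have cancel: "(?F + 1 + u) * (?F - (1 + u)) \<in> I 5"
    using ideal_diff[OF sq u2] by simp
  have u1: "u \<in> I 1" using u by (rule ideal_mono) simp
  have near2: "(?F + 1 + u) - 2 \<in> I 1"
    using ideal_add[OF row_quotient_cong_1 u1] by (simp add: algebra_simps)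
  have "?F - (1 + u) \<in> I 5"
  proof (rule ideal_cancel_unit[OF _ _ cancel])
    show "?F + 1 + u \<in> I 0"
      by (rule ideal_cong_mem[OF ideal_mono[OF near2] ideal_numeral(3)]) simp
    show "?F + 1 + u \<notin> I 1"
    proof
      assume "?F + 1 + u \<in> I 1"
      from ideal_diff[OF this near2] have "of_nat 2 \<in> I 1" by simp
      then show False using of_nat_notin_ideal_1[of 2] assms by simp
    qed
  qed
  then show ?thesis by (simp add: u_def W_def)
qed

text \<open>Since \<open>c * c\<close> lies in \<open>I 6\<close>, multiplying the row congruences
  merely adds their linear terms.\<close>

lemma row_quotient_prod_cong:
  assumes "p \<ge> 7"
  shows "(\<Prod>m<n. row_quotient p m)
    - (1 + of_nat p ^ 3 * (H1 (p - 1) / of_nat p ^ 2) * (\<Sum>m<n. of_nat m * (of_nat m + 1))) \<in> I 5"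
proof (induction n)
  case 0
  show ?case by (simp add: ideal_zero)
next
  case (Suc n)
  define c where "c = of_nat p ^ 3 * (H1 (p - 1) / of_nat p ^ 2)"
  define T where "T = (\<Sum>m<n. of_nat m * (of_nat m + 1) :: rat)"
  define t where "t = of_nat n * (of_nat n + 1 :: rat)"
  define G where "G = (\<Prod>m<n. row_quotient p m)"
  let ?F = "row_quotient p n"
  have c: "c \<in> I 3" unfolding c_def
    by (intro ideal_mult_right ideal_power_p wolstenholme_quotient_integral assms)
  then have c0: "c \<in> I 0" by (rule ideal_mono) simp
  have c2: "c * c \<in> I 5" using ideal_mono[OF ideal_mult[OF c c], of 5] by simp
  have T: "T \<in> I 0" and t: "t \<in> I 0" unfolding T_def t_def by (intro ideal_intros)+
  have F: "?F \<in> I 0" using unit_cong_1(1)[OF row_quotient_cong_1] .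
  have "G * ?F - (1 + c * (T + t))
      = ?F * (G - (1 + c * T)) + (1 + c * T) * (?F - (1 + c * t)) + (T * t) * (c * c)"
    by (simp add: algebra_simps)
  also have "\<dots> \<in> I 5"
    using Suc row_quotient_cong[OF assms, of n] unfolding c_def[symmetric] t_def[symmetric]
      T_def[symmetric] G_def[symmetric]
    by (intro ideal_add ideal_mult_left F T t c0 c2 ideal_numeral)
  finally show ?case by (simp add: G_def c_def T_def t_def)
qed

section \<open>Binomial quotients modulo \<open>p ^ 5\<close>\<close>

text \<open>The sum up to \<open>n\<close> is \<open>(n ^ 3 - n) / 3\<close>, and
  \<open>(r + s) ^ 3 - r ^ 3 - s ^ 3 = 3 * r * s * (r + s)\<close>. This is the source of
  \<open>n * r * (n - r)\<close> in the theorem.\<close>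

lemma sum_pronic_add:
  "(\<Sum>m<r+s. of_nat m * (of_nat m + 1) :: rat) = (\<Sum>m<r. of_nat m * (of_nat m + 1))
     + (\<Sum>m<s. of_nat m * (of_nat m + 1)) + of_nat (r + s) * of_nat r * of_nat s"
  by (induction s) (simp_all add: algebra_simps)

text \<open>All factors of the factorial formula other than the row quotients cancel. Writing
  \<open>n = r + s\<close> avoids truncated subtraction.\<close>

lemma binomial_ratio_eq:
  "of_nat (((r + s) * p) choose (r * p)) / of_nat ((r + s) choose r)
     = (\<Prod>m<r+s. row_quotient p m) / ((\<Prod>m<r. row_quotient p m) * (\<Prod>m<s. row_quotient p m))"
proof -
  have p: "p > 0" using prime_p by (rule prime_gt_0_nat)
  have "of_nat (((r + s) * p) choose (r * p)) = (fact ((r + s) * p) / (fact (r * p) * fact (s * p)) :: rat)"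
    by (subst binomial_fact) (auto simp: algebra_simps)
  moreover have "of_nat ((r + s) choose r) = (fact (r + s) / (fact r * fact s) :: rat)"
    by (subst binomial_fact) auto
  ultimately show ?thesis
    using p unfolding fact_mult_eq_prod_row_quotients[OF p]
    by (simp add: power_add)
qed

lemma binomial_ratio_cong:
  assumes p7: "p \<ge> 7"
  shows "of_nat (((r + s) * p) choose (r * p)) / of_nat ((r + s) choose r)
    - (1 + of_nat p ^ 3 * (H1 (p - 1) / of_nat p ^ 2) * (of_nat (r + s) * of_nat r * of_nat s)) \<in> I 5"
proof -
  define c where "c = of_nat p ^ 3 * (H1 (p - 1) / of_nat p ^ 2)"
  define T where "T n = (\<Sum>m<n. of_nat m * (of_nat m + 1) :: rat)" for n
  define G where "G n = (\<Prod>m<n. row_quotient p m)" for n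
  define N where "N = (of_nat (r + s) * of_nat r * of_nat s :: rat)"
  have c: "c \<in> I 3" unfolding c_def
    by (intro ideal_mult_right ideal_power_p wolstenholme_quotient_integral assms)
  then have c0: "c \<in> I 0" by (rule ideal_mono) simp
  have c2: "c * c \<in> I 5" using ideal_mono[OF ideal_mult[OF c c], of 5] by simp
  have T0: "T n \<in> I 0" for n unfolding T_def by (intro ideal_intros)
  have N0: "N \<in> I 0" unfolding N_def by (intro ideal_intros)
  have G1: "G n - 1 \<in> I 1" for n unfolding G_def by (intro prod_cong_1 row_quotient_cong_1)
  note G0 = unit_cong_1[OF G1]
  have G: "G n - (1 + c * T n) \<in> I 5" for n
    unfolding G_def c_def T_def by (rule row_quotient_prod_cong[OF p7])
  have T: "T (r + s) = T r + T s + N" unfolding T_def N_def by (rule sum_pronic_add)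
  have nz: "G n \<noteq> 0" for n using G0(2)[of n] ideal_zero by metis
  have "G r * (G s * (G (r + s) / (G r * G s) - (1 + c * N))) = G (r + s) - G r * G s * (1 + c * N)"
    using nz by (simp add: field_simps)
  \<comment> \<open>The terms linear in \<open>c\<close> cancel by the splitting of
    \<open>T (r + s)\<close>; what remains is the three known errors and a multiple of
    \<open>c * c\<close>.\<close>
  also have "\<dots> = (G (r + s) - (1 + c * T (r + s))) - (G s * (1 + c * N)) * (G r - (1 + c * T r))
       - ((1 + c * T r) * (1 + c * N)) * (G s - (1 + c * T s))
       - (T r * T s + T r * N + T s * N + c * T r * T s * N) * (c * c)"
    unfolding T by (simp add: algebra_simps)
  also have "\<dots> \<in> I 5"
    by (intro ideal_diff G ideal_add ideal_mult_left c2 c0 T0 N0 G0 ideal_numeral)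
  finally have "G s * (G (r + s) / (G r * G s) - (1 + c * N)) \<in> I 5"
    by (rule ideal_cancel_unit[OF G0])
  then have "G (r + s) / (G r * G s) - (1 + c * N) \<in> I 5"
    by (rule ideal_cancel_unit[OF G0])
  then show ?thesis unfolding binomial_ratio_eq G_def c_def N_def .
qed

section \<open>Integer residues and \<open>w\<close>\<close>

lemma of_int_mem_ideal_iff: "of_int a \<in> I k \<longleftrightarrow> int p ^ k dvd a"
proof (induction k arbitrary: a)
  case 0
  show ?case by (simp add: ideal_of_int)
next
  case (Suc k)
  have *: "of_int (int p * b) \<in> I (Suc k) \<longleftrightarrow> int p ^ Suc k dvd int p * b" for b
    using ideal_add_exponent_iff[of 1 "of_int b" k] Suc[of b] prime_gt_0_nat[OF prime_p] by simp
  show ?case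
  proof (cases "int p dvd a")
    case True
    then show ?thesis using * by auto
  next
    case False
    then have "of_int a \<notin> I (Suc k)" using ideal_1_of_int_iff ideal_mono by fastforce
    moreover have "\<not> int p ^ Suc k dvd a" using False dvd_trans[of "int p"] by auto
    ultimately show ?thesis by simp
  qed
qed

lemma residue_exists_unique:
  assumes "x \<in> I 0"
  shows "\<exists>!a. 0 \<le> a \<and> a < int p ^ k \<and> of_int a - x \<in> I k"
proof -
  obtain c d where x: "x = of_int c / of_int d" "\<not> int p dvd d" "d \<noteq> 0"
    using assms unfolding ideal_0_iff by (elim p_integralE)
  have "coprime (int p) d" using prime_p x(2) by (intro prime_imp_coprime) auto
  then have "coprime d (int p ^ k)" by (simp add: coprime_commute)
  then obtain b where "[d * b = 1] (mod int p ^ k)" using cong_solve_coprime_int by blast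
  then have db: "of_int (d * b - 1) \<in> I k"
    unfolding of_int_mem_ideal_iff cong_iff_dvd_diff .
  \<comment> \<open>The residue is the numerator times an inverse \<open>b\<close> of the
    denominator modulo \<open>p ^ k\<close>, reduced to the required range.\<close>
  define a where "a = (c * b) mod int p ^ k"
  have "int p ^ k dvd a - c * b" unfolding a_def by (simp add: mod_eq_dvd_iff[symmetric])
  then have ab: "of_int (a - c * b) \<in> I k" unfolding of_int_mem_ideal_iff .
  have "of_int a - x = of_int (a - c * b) + x * of_int (d * b - 1)"
    using x(3) by (simp add: x(1) field_simps)
  then have ax: "of_int a - x \<in> I k"
    using ideal_add[OF ab ideal_mult_left[OF assms db]] by (simp only:)
  have pk: "int p ^ k > 0" using prime_gt_0_nat[OF prime_p] by simp
  show ?thesis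
  proof (intro ex1I[of _ a] conjI ax)
    fix a' assume a': "0 \<le> a' \<and> a' < int p ^ k \<and> of_int a' - x \<in> I k"
    then have "of_int (a' - a) \<in> I k" using ideal_diff[of "of_int a' - x" k "of_int a - x"] ax by simp
    then have "a' mod int p ^ k = a mod int p ^ k"
      unfolding of_int_mem_ideal_iff by (simp add: mod_eq_dvd_iff)
    then show "a' = a" using a' pk by (simp add: a_def)
  qed (use pk in \<open>auto simp: a_def\<close>)
qed

lemma rat_cong_iff: "x \<in> I 0 \<Longrightarrow> y \<in> I 0 \<Longrightarrow> rat_cong p k x y \<longleftrightarrow> x - y \<in> I k"
  by (simp add: rat_cong_def ideal_0_iff) (simp add: padic_ideal_def)

text \<open>Existence and uniqueness of the residue make the definite description in
  \<open>w\<close> denote it.\<close>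

lemma w_cong:
  assumes "p \<ge> 7"
  shows "of_int (w p) - H1 (p - 1) / of_nat p ^ 2 \<in> I 2"
proof -
  note W = wolstenholme_quotient_integral[OF assms]
  have "\<exists>!a. 0 \<le> a \<and> a < int p ^ 2 \<and> rat_cong p 2 (of_int a) (H1 (p - 1) / of_nat p ^ 2)"
    using residue_exists_unique[OF W, of 2] by (simp only: rat_cong_iff[OF ideal_of_int W])
  from theI'[OF this] have "rat_cong p 2 (of_int (w p)) (H1 (p - 1) / of_nat p ^ 2)"
    unfolding w_def by blast
  then show ?thesis unfolding rat_cong_iff[OF ideal_of_int W] .
qed

lemma binomial_ratio_integral:
  assumes "p \<ge> 7"
  shows "of_nat (((r + s) * p) choose (r * p)) / of_nat ((r + s) choose r) \<in> I 0"
  by (rule ideal_cong_mem[OF ideal_mono[OF binomial_ratio_cong[OF assms]]])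
    (intro le0 ideal_intros wolstenholme_quotient_integral[OF assms])+

section \<open>The congruence with \<open>w\<close> and the Bernoulli criterion\<close>

text \<open>The factor \<open>p ^ 3\<close> turns the error modulo \<open>p ^ 2\<close> in replacing
  the Wolstenholme quotient by \<open>w p\<close> into one modulo \<open>p ^ 5\<close>.\<close>

lemma binomial_ratio_rat_cong_5:
  assumes "p \<ge> 7" "r \<le> n"
  shows "rat_cong p 5 (of_nat ((n * p) choose (r * p)) / of_nat (n choose r))
    (1 + of_int (w p) * of_nat n * of_nat r * (of_nat n - of_nat r) * of_nat p ^ 3)"
proof -
  define s where "s = n - r"
  have n: "n = r + s" using assms(2) by (simp add: s_def)
  let ?R = "of_nat (((r + s) * p) choose (r * p)) / of_nat ((r + s) choose r) :: rat"
  let ?W = "H1 (p - 1) / of_nat p ^ 2"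
  let ?N = "of_nat (r + s) * of_nat r * of_nat s :: rat"
  have "of_nat p ^ 3 * (of_int (w p) - ?W) \<in> I (3 + 2)"
    by (intro ideal_mult ideal_power_p w_cong assms)
  then have "(of_nat p ^ 3 * (of_int (w p) - ?W)) * ?N \<in> I (3 + 2)"
    by (rule ideal_mult_right) (intro ideal_mult_left ideal_of_nat)
  then have "(of_nat p ^ 3 * (of_int (w p) - ?W)) * ?N \<in> I 5" by simp
  then have "(?R - (1 + of_nat p ^ 3 * ?W * ?N)) - (of_nat p ^ 3 * (of_int (w p) - ?W)) * ?N \<in> I 5"
    by (rule ideal_diff[OF binomial_ratio_cong[OF assms(1)]])
  also have "(?R - (1 + of_nat p ^ 3 * ?W * ?N)) - (of_nat p ^ 3 * (of_int (w p) - ?W)) * ?N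
      = ?R - (1 + of_int (w p) * of_nat (r + s) * of_nat r * (of_nat (r + s) - of_nat r) * of_nat p ^ 3)"
    by (simp add: right_diff_distrib left_diff_distrib ac_simps)
  finally show ?thesis
    unfolding n
    by (subst rat_cong_iff) (auto intro!: ideal_intros binomial_ratio_integral assms)
qed

lemma binomial_ratio_rat_cong_4_iff:
  assumes "p \<ge> 7"
  shows "(\<forall>n r. r \<le> n \<longrightarrow> rat_cong p 4 (of_nat ((n * p) choose (r * p)) / of_nat (n choose r)) 1)
    \<longleftrightarrow> H1 (p - 1) / of_nat p ^ 2 \<in> I 1" (is "?L \<longleftrightarrow> ?W \<in> I 1")
proof
  assume L: ?L
  \<comment> \<open>The case \<open>n = 2\<close>, \<open>r = 1\<close> suffices: there
    \<open>n * r * (n - r)\<close> is 2, a unit.\<close>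
  let ?R = "of_nat (((1 + 1) * p) choose (1 * p)) / of_nat ((1 + 1) choose 1) :: rat"
  have "rat_cong p 4 ?R 1" using L by (metis le_add1)
  then have "?R - 1 \<in> I 4"
    using rat_cong_iff[OF binomial_ratio_integral[OF assms] ideal_numeral(2)] by blast
  moreover have "?R - (1 + of_nat p ^ 3 * ?W * (of_nat (1 + 1) * of_nat 1 * of_nat 1)) \<in> I 4"
    by (rule ideal_mono[OF binomial_ratio_cong[OF assms]]) simp
  ultimately have "(?R - 1)
      - (?R - (1 + of_nat p ^ 3 * ?W * (of_nat (1 + 1) * of_nat 1 * of_nat 1))) \<in> I (3 + 1)"
    using ideal_diff by fastforce
  then have "of_nat p ^ 3 * (of_nat 2 * ?W) \<in> I (3 + 1)" by (simp add: algebra_simps)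
  then have "of_nat 2 * ?W \<in> I 1" unfolding ideal_add_exponent_iff .
  then show "?W \<in> I 1" by (rule ideal_cancel_of_nat[rotated 2]) (use assms in auto)
next
  assume W: "?W \<in> I 1"
  show ?L
  proof (intro allI impI)
    fix n r :: nat assume "r \<le> n"
    then obtain s where n: "n = r + s" using le_Suc_ex by blast
    let ?R = "of_nat (((r + s) * p) choose (r * p)) / of_nat ((r + s) choose r) :: rat"
    let ?u = "of_nat p ^ 3 * ?W * (of_nat (r + s) * of_nat r * of_nat s)"
    have "?u \<in> I (3 + 1)"
      by (intro ideal_mult_right ideal_mult[OF ideal_power_p W] ideal_intros)
    then have "?u \<in> I 4" by simp
    moreover have "?R - (1 + ?u) \<in> I 4"
      by (rule ideal_mono[OF binomial_ratio_cong[OF assms]]) simp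
    ultimately have "?R - (1 + ?u) + ?u \<in> I 4" by (intro ideal_add)
    then have "?R - 1 \<in> I 4" by simp
    then show "rat_cong p 4 (of_nat ((n * p) choose (r * p)) / of_nat (n choose r)) 1"
      unfolding n using rat_cong_iff[OF binomial_ratio_integral[OF assms] ideal_numeral(2)] by blast
  qed
qed

text \<open>Modulo \<open>p\<close> the Bernoulli number is -3 times the Wolstenholme quotient, and
  3 is a unit.\<close>

lemma wolstenholme_quotient_mem_iff:
  assumes "p \<ge> 7"
  shows "H1 (p - 1) / of_nat p ^ 2 \<in> I 1 \<longleftrightarrow> int p dvd fst (quotient_of (bernoulli (p - 3)))"
    (is "?W \<in> I 1 \<longleftrightarrow> _")
proof -
  note B = wolstenholme_quotient_bernoulli[OF assms]
  have "?W \<in> I 1 \<longleftrightarrow> bernoulli (p - 3) \<in> I 1"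
  proof
    assume "?W \<in> I 1"
    then have "3 * ?W \<in> I 1" by (rule ideal_mult_left[OF ideal_numeral(3)])
    from ideal_diff[OF B this] show "bernoulli (p - 3) \<in> I 1" by simp
  next
    assume "bernoulli (p - 3) \<in> I 1"
    then have "of_nat 3 * ?W \<in> I 1" using ideal_diff[OF B] by fastforce
    then show "?W \<in> I 1" by (rule ideal_cancel_of_nat[rotated 2]) (use assms in auto)
  qed
  also have "\<dots> \<longleftrightarrow> int p dvd fst (quotient_of (bernoulli (p - 3)))"
    using assms by (intro ideal_1_iff_numerator bernoulli_integral) auto
  finally show ?thesis .
qed

end

theorem theorem3p2:
  fixes p :: nat
  assumes "prime p" and "p \<ge> 7"
  shows "(\<forall>n r :: nat. r \<le> n \<longrightarrow>
            rat_cong p 5 (of_nat ((n * p) choose (r * p)) / of_nat (n choose r))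
              (1 + of_int (w p) * of_nat n * of_nat r * (of_nat n - of_nat r) * of_nat p ^ 3)) \<and>
         ((\<forall>n r :: nat. r \<le> n \<longrightarrow>
            rat_cong p 4 (of_nat ((n * p) choose (r * p)) / of_nat (n choose r)) 1) \<longleftrightarrow>
          int p dvd fst (quotient_of (bernoulli (p - 3))))"
  using binomial_ratio_rat_cong_5[OF assms] binomial_ratio_rat_cong_4_iff[OF assms]
    wolstenholme_quotient_mem_iff[OF assms] by blast

end
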